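(* Let $0<x<\pi/2$. For every integer $p\ge 3$, the two double inequalities $$\frac{4}{\pi^2}\left(1-\cosh\left(\frac{\pi}{2}\right)\operatorname{sech}\left(\frac{\pi}{2p}\right)\right)<\frac{1-\frac{\cosh x}{\cosh (x/p)}}{x^2}<\frac{1-p^2}{2p^2}$$ and $$\frac{4}{\pi^2}\left(p-\sinh\left(\frac{\pi}{2}\right)\operatorname{csch}\left(\frac{\pi}{2p}\right)\right)<\frac{p-\frac{\sinh x}{\sinh (x/p)}}{x^2}<\frac{1-p^2}{6p}$$ hold. Moreover, for $p=2$ the second double inequality remains true, while the first is reversed, i.e. for $p=2$ $$\frac{1-p^2}{2p^2}<\frac{1-\frac{\cosh x}{\cosh (x/p)}}{x^2}<\frac{4}{\pi^2}\left(1-\cosh\left(\frac{\pi}{2}\right)\operatorname{sech}\left(\frac{\pi}{2p}\right)\right).$$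
   Context: Here $\operatorname{sech} t=1/\cosh t$ and $\operatorname{csch} t=1/\sinh t$. *)

theory Defs
  imports Complex_Main
begin

definition sech :: "real \<Rightarrow> real" where
  "sech t = 1 / cosh t"

definition csch :: "real \<Rightarrow> real" where
  "csch t = 1 / sinh t"

end

theory Submission
  imports Defs "HOL-Real_Asymp.Real_Asymp" "HOL-Analysis.Complex_Transcendental"
begin

text \<open>
  Put \<open>t = x / p\<close>, so that both quotients become functions of \<open>t\<close> with bounds given by their limits at
  \<open>0\<close> and values at \<open>\<pi> / (2 p)\<close>; it suffices to see that they are monotone. For the hyperbolic sine,
  \<open>sinh (p t) / sinh t\<close> is a sum of terms \<open>cosh (m t)\<close>, and each \<open>(cosh (m t) - 1) / t\<^sup>2\<close> increases.
  For the hyperbolic cosine, \<open>cosh (p t) - cosh t = 2 sinh (a t) sinh (b t)\<close> with \<open>a = (p + 1) / 2\<close> and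
  \<open>b = (p - 1) / 2\<close>; after division by \<open>t\<^sup>2 cosh t\<close> this is
  \<open>4 (sinh t / t)\<^sup>2 (sinh (a t) / sinh (2 t)) (sinh (b t) / sinh t)\<close>, whose factors all increase as
  soon as \<open>a \<ge> 2\<close> and \<open>b \<ge> 1\<close>, that is \<open>p \<ge> 3\<close>. For \<open>p = 2\<close> the sign of the derivative reduces to
  an upper bound of \<open>t / 2\<close> by a cubic polynomial in \<open>tanh (t / 2)\<close>, valid on the short interval needed.
\<close>

section \<open>Monotonicity from derivatives and elementary bounds for \<open>sinh\<close> and
  \<open>cosh\<close>\<close>

lemma less_of_deriv_pos:
  fixes f f' :: "real \<Rightarrow> real"
  assumes "s < t" and "\<And>u. s < u \<Longrightarrow> u < t \<Longrightarrow> f' u > 0"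
    and der: "\<And>u. s \<le> u \<Longrightarrow> u \<le> t \<Longrightarrow> (f has_real_derivative f' u) (at u)"
  shows "f s < f t"
proof (rule DERIV_pos_imp_increasing_open[OF \<open>s < t\<close>])
  show "\<exists>y. (f has_real_derivative y) (at u) \<and> 0 < y" if "s < u" "u < t" for u
    using assms(2)[OF that] der[of u] that by auto
  show "continuous_on {s..t} f"
    by (intro continuous_at_imp_continuous_on ballI DERIV_isCont[OF der]) auto
qed

lemma one_less_cosh: "0 < t \<Longrightarrow> 1 < cosh t" for t :: real
  using cosh_real_nonneg_less_iff[of 0 t] by simp

lemma less_sinh:
  fixes t :: real
  assumes "0 < t" shows "t < sinh t"
proof -
  have "sinh 0 - 0 < sinh t - t"
    by (rule less_of_deriv_pos[where f' = "\<lambda>u. cosh u - 1"])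
      (use assms in \<open>auto intro!: derivative_eq_intros simp: one_less_cosh\<close>)
  then show ?thesis by simp
qed

lemma sinh_less_mult_cosh:
  fixes t :: real
  assumes "0 < t" shows "sinh t < t * cosh t"
proof -
  have "0 * cosh 0 - sinh 0 < t * cosh t - sinh t"
    by (rule less_of_deriv_pos[where f' = "\<lambda>u. u * sinh u"])
      (use assms in \<open>auto intro!: derivative_eq_intros\<close>)
  then show ?thesis by simp
qed

lemma sinh_div_self_strict_mono:
  fixes s t :: real
  assumes "0 < s" "s < t" shows "sinh s / s < sinh t / t"
  by (rule less_of_deriv_pos[where f = "\<lambda>u. sinh u / u"
        and f' = "\<lambda>u. (u * cosh u - sinh u) / u\<^sup>2"])
    (use assms sinh_less_mult_cosh in
      \<open>auto intro!: derivative_eq_intros simp: power2_eq_square mult.commute\<close>)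

text \<open>Both sides vanish at \<open>t = 0\<close>, and their derivatives compare as
  \<open>cosh (b * t)\<close> and \<open>cosh (a * t)\<close>. This bounds the quotient of the two
  \<open>sinh\<close> values below by its limit \<open>a / b\<close> at 0.\<close>

lemma sinh_mult_ge:
  fixes a b t :: real
  assumes "0 < b" "b \<le> a" "0 \<le> t"
  shows "a * sinh (b * t) \<le> b * sinh (a * t)"
proof -
  have "b * sinh (a * 0) - a * sinh (b * 0) \<le> b * sinh (a * t) - a * sinh (b * t)"
  proof (rule DERIV_nonneg_imp_nondecreasing[OF assms(3)])
    fix u :: real assume "0 \<le> u" "u \<le> t"
    then have "cosh (b * u) \<le> cosh (a * u)"
      using assms by (simp add: cosh_real_nonneg_le_iff mult_right_mono)
    then have "0 \<le> a * b * (cosh (a * u) - cosh (b * u))"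
      using assms by simp
    moreover have "((\<lambda>u. b * sinh (a * u) - a * sinh (b * u)) has_real_derivative
        a * b * (cosh (a * u) - cosh (b * u))) (at u)"
      by (auto intro!: derivative_eq_intros simp: algebra_simps)
    ultimately show "\<exists>y. ((\<lambda>u. b * sinh (a * u) - a * sinh (b * u))
        has_real_derivative y) (at u) \<and> 0 \<le> y" by blast
  qed
  then show ?thesis by simp
qed

text \<open>The numerator \<open>?D\<close> of the derivative of the quotient vanishes at 0, and in
  its own derivative the \<open>cosh\<close> products cancel, so \<open>?D\<close> is
  nonnegative.\<close>

lemma sinh_mult_div_sinh_mono:
  fixes a b s t :: real
  assumes "0 < b" "b \<le> a" "0 < s" "s \<le> t"
  shows "sinh (a * s) / sinh (b * s) \<le> sinh (a * t) / sinh (b * t)"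
proof (rule DERIV_nonneg_imp_nondecreasing[OF assms(4)])
  fix u :: real assume "s \<le> u" "u \<le> t"
  then have u: "u > 0" using assms by simp
  let ?D = "\<lambda>u. a * cosh (a * u) * sinh (b * u) - b * sinh (a * u) * cosh (b * u)"
  have "?D 0 \<le> ?D u"
  proof (rule DERIV_nonneg_imp_nondecreasing[of 0 u])
    fix v :: real assume "0 \<le> v"
    have "b\<^sup>2 \<le> a\<^sup>2" using assms by (intro power_mono) auto
    then have "0 \<le> (a\<^sup>2 - b\<^sup>2) * (sinh (a * v) * sinh (b * v))"
      using assms \<open>0 \<le> v\<close> by (intro mult_nonneg_nonneg) auto
    moreover have "(?D has_real_derivative (a\<^sup>2 - b\<^sup>2) * (sinh (a * v) * sinh (b * v))) (at v)"
      by (auto intro!: derivative_eq_intros simp: algebra_simps power2_eq_square)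
    ultimately show "\<exists>y. (?D has_real_derivative y) (at v) \<and> 0 \<le> y" by blast
  qed (use u in auto)
  then have "0 \<le> ?D u / (sinh (b * u))\<^sup>2" by simp
  moreover have "((\<lambda>u. sinh (a * u) / sinh (b * u)) has_real_derivative
      ?D u / (sinh (b * u))\<^sup>2) (at u)"
    using assms u
    by (auto intro!: derivative_eq_intros simp: power2_eq_square algebra_simps)
  ultimately show "\<exists>y. ((\<lambda>u. sinh (a * u) / sinh (b * u)) has_real_derivative y) (at u) \<and> 0 \<le> y"
    by blast
qed

section \<open>The function \<open>(cosh t - 1) / t^2\<close> and its rescalings\<close>

lemma cosh_minus_one: "cosh t - 1 = 2 * (sinh (t / 2))\<^sup>2" for t :: real
  using cosh_double[of "t / 2"] cosh_square_eq[of "t / 2"] by simp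

text \<open>The half-angle form transfers monotonicity and the bound at 0 from
  \<open>sinh t / t\<close>.\<close>

lemma cosh_minus_one_div_sq: "(cosh t - 1) / t\<^sup>2 = (sinh (t / 2) / (t / 2))\<^sup>2 / 2" for t :: real
  by (simp add: cosh_minus_one power_divide)

lemma cosh_minus_one_div_sq_strict_mono:
  fixes s t :: real
  assumes "0 < s" "s < t" shows "(cosh s - 1) / s\<^sup>2 < (cosh t - 1) / t\<^sup>2"
  unfolding cosh_minus_one_div_sq
  using assms sinh_div_self_strict_mono[of "s / 2" "t / 2"]
  by (intro divide_strict_right_mono power_strict_mono) auto

lemma half_less_cosh_minus_one_div_sq:
  fixes t :: real
  assumes "0 < t" shows "1 / 2 < (cosh t - 1) / t\<^sup>2"
proof -
  have "1 < sinh (t / 2) / (t / 2)" using assms less_sinh[of "t / 2"] by simp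
  then have "1 < (sinh (t / 2) / (t / 2))\<^sup>2" by (intro one_less_power) auto
  then show ?thesis unfolding cosh_minus_one_div_sq by linarith
qed

text \<open>Since \<open>cosh\<close> is even, negative frequencies \<open>m\<close>, which occur in
  the sum below, reduce to positive arguments.\<close>

lemma cosh_mult_minus_one_div_sq:
  fixes m t :: real
  assumes "m \<noteq> 0"
  shows "(cosh (m * t) - 1) / t\<^sup>2 = m\<^sup>2 * ((cosh (\<bar>m\<bar> * t) - 1) / (\<bar>m\<bar> * t)\<^sup>2)"
  using assms by (cases "m \<ge> 0") (auto simp: power_mult_distrib)

lemma cosh_mult_minus_one_div_sq_strict_mono:
  fixes m s t :: real
  assumes "m \<noteq> 0" "0 < s" "s < t"
  shows "(cosh (m * s) - 1) / s\<^sup>2 < (cosh (m * t) - 1) / t\<^sup>2"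
  unfolding cosh_mult_minus_one_div_sq[OF assms(1)]
  using assms by (intro mult_strict_left_mono cosh_minus_one_div_sq_strict_mono) auto

lemma less_cosh_mult_minus_one_div_sq:
  fixes m t :: real
  assumes "m \<noteq> 0" "0 < t"
  shows "m\<^sup>2 / 2 < (cosh (m * t) - 1) / t\<^sup>2"
proof -
  have "m\<^sup>2 * (1 / 2) < (cosh (m * t) - 1) / t\<^sup>2"
    unfolding cosh_mult_minus_one_div_sq[OF assms(1)]
    using assms by (intro mult_strict_left_mono half_less_cosh_minus_one_div_sq) auto
  then show ?thesis by simp
qed

section \<open>The quotient of hyperbolic sines\<close>

text \<open>A hyperbolic Dirichlet kernel: \<open>2 * sinh t * cosh (m * t)\<close> is
  \<open>sinh ((m + 1) * t) - sinh ((m - 1) * t)\<close>, and the frequencies \<open>m\<close> have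
  step 2, so the sum telescopes.\<close>

lemma sinh_mult_eq_sum_cosh:
  fixes t :: real
  shows "sinh (real n * t) = sinh t * (\<Sum>k<n. cosh ((2 * real k + 1 - real n) * t))"
proof -
  have "2 * (sinh t * cosh ((2 * real k + 1 - real n) * t))
      = sinh ((2 * real (Suc k) - real n) * t) - sinh ((2 * real k - real n) * t)" for k
  proof -
    have "(2 * real (Suc k) - real n) * t = (2 * real k + 1 - real n) * t + t"
      "(2 * real k - real n) * t = (2 * real k + 1 - real n) * t - t"
      by (simp_all add: algebra_simps)
    then show ?thesis by (simp only: sinh_add sinh_diff) simp
  qed
  then have "2 * (sinh t * (\<Sum>k<n. cosh ((2 * real k + 1 - real n) * t)))
      = (\<Sum>k<n. sinh ((2 * real (Suc k) - real n) * t) - sinh ((2 * real k - real n) * t))"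
    by (simp add: sum_distrib_left)
  \<comment> \<open>The end terms are \<open>sinh (n * t)\<close> and
    \<open>- sinh (- n * t)\<close>, which are equal and account for the factor 2.\<close>
  also have "\<dots> = sinh ((2 * real n - real n) * t) - sinh ((2 * real 0 - real n) * t)"
    by (rule sum_lessThan_telescope)
  finally show ?thesis by simp
qed

lemma sum_sq_symmetric:
  "(\<Sum>k<n. (2 * real k + 1 - real n)\<^sup>2) = real n * ((real n)\<^sup>2 - 1) / 3"
proof -
  \<comment> \<open>The induction needs the number of terms \<open>m\<close> separated from the
    shift \<open>c\<close>; both are \<open>n\<close> in the end.\<close>
  have "(\<Sum>k<m. (2 * real k + 1 - c)\<^sup>2)
      = real m * (4 * (real m)\<^sup>2 - 1) / 3 - 2 * c * (real m)\<^sup>2 + real m * c\<^sup>2" for m c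
    by (induction m) (auto simp: field_simps power2_eq_square)
  from this[of "real n" n] show ?thesis by (simp add: field_simps power2_eq_square)
qed

text \<open>The quotient of the theorem is \<open>- sinh_quot n (x / n) / n^2\<close>; the change of
  sign makes this function increasing.\<close>

definition sinh_quot :: "nat \<Rightarrow> real \<Rightarrow> real" where
  "sinh_quot n t = (sinh (real n * t) / sinh t - real n) / t\<^sup>2"

lemma sinh_quot_eq_sum:
  assumes "0 < t"
  shows "sinh_quot n t = (\<Sum>k<n. (cosh ((2 * real k + 1 - real n) * t) - 1) / t\<^sup>2)"
  using assms unfolding sinh_quot_def sinh_mult_eq_sum_cosh
  by (simp add: sum_divide_distrib[symmetric] sum_subtractf)

lemma sinh_quot_strict_mono:
  assumes "2 \<le> n" "0 < s" "s < t"
  shows "sinh_quot n s < sinh_quot n t"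
proof -
  \<comment> \<open>For odd \<open>n\<close> the middle frequency is 0 and its term is constant, so
    strictness is taken from \<open>k = 0\<close>, whose frequency \<open>1 - n\<close> is
    nonzero.\<close>
  have "(\<Sum>k<n. (cosh ((2 * real k + 1 - real n) * s) - 1) / s\<^sup>2)
      < (\<Sum>k<n. (cosh ((2 * real k + 1 - real n) * t) - 1) / t\<^sup>2)"
  proof (rule sum_strict_mono_ex1)
    show "\<forall>k\<in>{..<n}. (cosh ((2 * real k + 1 - real n) * s) - 1) / s\<^sup>2
        \<le> (cosh ((2 * real k + 1 - real n) * t) - 1) / t\<^sup>2"
    proof
      fix k
      show "(cosh ((2 * real k + 1 - real n) * s) - 1) / s\<^sup>2
        \<le> (cosh ((2 * real k + 1 - real n) * t) - 1) / t\<^sup>2"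
        using cosh_mult_minus_one_div_sq_strict_mono[OF _ assms(2,3), of "2 * real k + 1 - real n"]
        by (cases "2 * real k + 1 - real n = 0") auto
    qed
    show "\<exists>k\<in>{..<n}. (cosh ((2 * real k + 1 - real n) * s) - 1) / s\<^sup>2
        < (cosh ((2 * real k + 1 - real n) * t) - 1) / t\<^sup>2"
      using assms by (intro bexI[of _ 0] cosh_mult_minus_one_div_sq_strict_mono) auto
  qed auto
  then show ?thesis using assms by (simp only: sinh_quot_eq_sum)
qed

text \<open>The bound is the limit at 0, obtained by summing the termwise bounds
  \<open>m^2 / 2\<close>.\<close>

lemma less_sinh_quot:
  assumes "2 \<le> n" "0 < t"
  shows "real n * ((real n)\<^sup>2 - 1) / 6 < sinh_quot n t"
proof -
  have "(\<Sum>k<n. (2 * real k + 1 - real n)\<^sup>2 / 2)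
      < (\<Sum>k<n. (cosh ((2 * real k + 1 - real n) * t) - 1) / t\<^sup>2)"
  proof (rule sum_strict_mono_ex1)
    show "\<forall>k\<in>{..<n}. (2 * real k + 1 - real n)\<^sup>2 / 2
        \<le> (cosh ((2 * real k + 1 - real n) * t) - 1) / t\<^sup>2"
    proof
      fix k
      show "(2 * real k + 1 - real n)\<^sup>2 / 2 \<le> (cosh ((2 * real k + 1 - real n) * t) - 1) / t\<^sup>2"
        using less_cosh_mult_minus_one_div_sq[OF _ assms(2), of "2 * real k + 1 - real n"]
        by (cases "2 * real k + 1 - real n = 0") auto
    qed
    show "\<exists>k\<in>{..<n}. (2 * real k + 1 - real n)\<^sup>2 / 2
        < (cosh ((2 * real k + 1 - real n) * t) - 1) / t\<^sup>2"
      using assms by (intro bexI[of _ 0] less_cosh_mult_minus_one_div_sq) auto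
  qed auto
  then show ?thesis
    using assms by (simp add: sinh_quot_eq_sum sum_divide_distrib[symmetric] sum_sq_symmetric)
qed

section \<open>The quotient of hyperbolic cosines for \<open>p\<close> at least 3\<close>

definition cosh_quot :: "real \<Rightarrow> real \<Rightarrow> real" where
  "cosh_quot p t = (cosh (p * t) / cosh t - 1) / t\<^sup>2"

text \<open>The factorisation is built around the case \<^term>\<open>p = (3::real)\<close>, where the last two factors are 1.\<close>
lemma cosh_quot_factor:
  assumes "0 < t"
  shows "cosh_quot p t = 4 * (sinh t / t)\<^sup>2
    * (sinh ((p + 1) / 2 * t) / sinh (2 * t)) * (sinh ((p - 1) / 2 * t) / sinh (1 * t))"
proof -
  let ?A = "(p + 1) / 2 * t" and ?B = "(p - 1) / 2 * t"
  have "p * t = ?A + ?B" "t = ?A - ?B" by (simp_all add: field_simps)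
  then have "cosh (p * t) - cosh t = cosh (?A + ?B) - cosh (?A - ?B)" by simp
  also have "\<dots> = 2 * sinh ?A * sinh ?B" by (simp only: cosh_add cosh_diff)
  finally have *: "cosh (p * t) - cosh t = 2 * sinh ?A * sinh ?B" .
  have "cosh_quot p t = (cosh (p * t) - cosh t) / (cosh t * t\<^sup>2)"
    unfolding cosh_quot_def by (simp add: field_simps)
  then show ?thesis
    unfolding * sinh_double using assms by (simp add: power2_eq_square mult_ac)
qed

lemma cosh_quot_strict_mono:
  assumes "3 \<le> p" "0 < s" "s < t"
  shows "cosh_quot p s < cosh_quot p t"
proof -
  have sq: "(sinh s / s)\<^sup>2 < (sinh t / t)\<^sup>2"
    using assms sinh_div_self_strict_mono by (intro power_strict_mono) auto
  have A: "sinh ((p + 1) / 2 * s) / sinh (2 * s) \<le> sinh ((p + 1) / 2 * t) / sinh (2 * t)"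
    and B: "sinh ((p - 1) / 2 * s) / sinh (1 * s) \<le> sinh ((p - 1) / 2 * t) / sinh (1 * t)"
    using assms by (intro sinh_mult_div_sinh_mono; simp)+
  have pos: "0 < sinh ((p + 1) / 2 * s) / sinh (2 * s)" "0 < sinh ((p - 1) / 2 * s) / sinh (1 * s)"
    using assms by (auto intro!: divide_pos_pos mult_pos_pos)
  \<comment> \<open>Strictness comes from the squared factor; the quotients of \<open>sinh\<close>
    values may be constant.\<close>
  have "4 * (sinh s / s)\<^sup>2 * (sinh ((p + 1) / 2 * s) / sinh (2 * s))
      < 4 * (sinh t / t)\<^sup>2 * (sinh ((p + 1) / 2 * t) / sinh (2 * t))"
    by (rule mult_less_le_imp_less) (use sq A pos in auto)
  then show ?thesis
    unfolding cosh_quot_factor[OF assms(2)] cosh_quot_factor[OF order.strict_trans[OF assms(2,3)]]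
    by (rule mult_less_le_imp_less[OF _ B]) (use pos in \<open>simp_all del: times_divide_eq_right\<close>)
qed

text \<open>Each factor is bounded below by its limit at 0, and the product of these limits is the
  claimed bound.\<close>

lemma less_cosh_quot:
  assumes "3 \<le> p" "0 < t"
  shows "(p\<^sup>2 - 1) / 2 < cosh_quot p t"
proof -
  have "1 < sinh t / t" using assms less_sinh by simp
  then have sq: "1 < (sinh t / t)\<^sup>2" by (intro one_less_power) auto
  have A: "(p + 1) / 4 \<le> sinh ((p + 1) / 2 * t) / sinh (2 * t)"
    using assms sinh_mult_ge[of 2 "(p + 1) / 2" t] by (simp add: field_simps)
  have B: "(p - 1) / 2 \<le> sinh ((p - 1) / 2 * t) / sinh (1 * t)"
    using assms sinh_mult_ge[of 1 "(p - 1) / 2" t] by (simp add: field_simps)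
  have "4 * 1 * ((p + 1) / 4) * ((p - 1) / 2) < cosh_quot p t"
    unfolding cosh_quot_factor[OF assms(2)]
    using sq A B assms
    by (intro mult_less_le_imp_less[OF mult_less_le_imp_less]) auto
  then show ?thesis by (simp add: power2_eq_square field_simps)
qed

section \<open>The quotient of hyperbolic cosines for \<open>p = 2\<close>\<close>

lemma tanh_sq_less:
  fixes v :: real
  assumes "0 < v" "v < 2 / 5"
  shows "tanh v ^ 2 < 1 / 5"
proof -
  have "tanh v < v"
    using sinh_less_mult_cosh[OF assms(1)] by (simp add: tanh_def field_simps)
  then have "tanh v ^ 2 < (2 / 5) ^ 2" using assms by (intro power_strict_mono) auto
  then show ?thesis by (simp add: power2_eq_square)
qed

text \<open>
  The constant \<open>9/20\<close> lies between \<open>5/12\<close>, above which the derivative stays positive up to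
  \<open>(tanh v)\<^sup>2 = 1/5\<close>, and \<open>5/11\<close>, the largest value that suits \<open>cosh_quot_2_deriv_neg\<close>, where
  \<open>cosh t < 3/2\<close>.
\<close>
lemma less_tanh_cubic:
  fixes u :: real
  assumes "0 < u" "u < 2 / 5"
  shows "u < tanh u + 9 / 20 * tanh u ^ 3"
proof -
  have "tanh 0 + 9 / 20 * tanh 0 ^ 3 - 0 < tanh u + 9 / 20 * tanh u ^ 3 - u"
  proof (rule less_of_deriv_pos[OF assms(1), where
      f' = "\<lambda>v. (1 - tanh v ^ 2) * (1 + 27 / 20 * tanh v ^ 2) - 1"])
    fix v assume v: "0 < v" "v < u"
    define w where "w = tanh v ^ 2"
    have w: "0 < w" "w < 1 / 5"
      using v assms tanh_sq_less[of v] by (auto simp: w_def)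
    then have "0 < w * (7 / 20 - 27 / 20 * w)" by (intro mult_pos_pos) auto
    then show "0 < (1 - tanh v ^ 2) * (1 + 27 / 20 * tanh v ^ 2) - 1"
      unfolding w_def[symmetric] by (simp add: algebra_simps)
  next
    show "((\<lambda>v. tanh v + 9 / 20 * tanh v ^ 3 - v) has_real_derivative
        (1 - tanh v ^ 2) * (1 + 27 / 20 * tanh v ^ 2) - 1) (at v)" for v :: real
      by (auto intro!: derivative_eq_intros simp: field_simps power2_eq_square)
  qed
  then show ?thesis by simp
qed

text \<open>With \<open>c = cosh t\<close>, \<open>cosh (2 * t) - c\<close> factors as
  \<open>(c - 1) * (2 * c + 1)\<close>. The first factor of the result increases and the second
  decreases, so factorwise monotonicity fails and the derivative is studied instead.\<close>

lemma cosh_quot_2: "cosh_quot 2 t = (cosh t - 1) / t\<^sup>2 * (2 + 1 / cosh t)"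
proof -
  have "cosh (2 * t) / cosh t - 1 = (cosh t - 1) * (2 + 1 / cosh t)"
    unfolding cosh_double_cosh by (simp add: field_simps power2_eq_square)
  then show ?thesis by (simp add: cosh_quot_def)
qed

text \<open>This is the sign of the numerator of the derivative of \<open>cosh_quot 2\<close>. As
  \<open>c - 1 = T * sinh t\<close>, dividing by \<open>sinh t\<close> leaves
  \<open>t * (2 * c^2 + 1) < 2 * c * (2 * c + 1) * T\<close>, which follows from the cubic bound for
  \<open>t / 2\<close>.\<close>

lemma cosh_quot_2_deriv_neg:
  fixes t :: real
  assumes "0 < t" "t < 4 / 5"
  shows "t * sinh t * (2 * (cosh t)\<^sup>2 + 1) < 2 * cosh t * (2 * cosh t + 1) * (cosh t - 1)"
proof -
  define c where "c = cosh t"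
  define T where "T = tanh (t / 2)"
  have T: "0 < T" using assms by (simp add: T_def)
  have c1: "1 < c" using assms by (simp add: c_def one_less_cosh)
  have s: "sinh t = T * (c + 1)" and cm1: "c - 1 = T\<^sup>2 * (c + 1)"
    using cosh_double_cosh[of "t / 2"] cosh_minus_one[of t] sinh_double[of "t / 2"]
    by (simp_all add: c_def T_def tanh_def power2_eq_square)
  have "T\<^sup>2 < 1 / 5" using tanh_sq_less[of "t / 2"] assms by (simp add: T_def)
  then have "T\<^sup>2 * (c + 1) < 1 / 5 * (c + 1)" using c1 by (intro mult_strict_right_mono) auto
  then have c2: "c < 3 / 2" using cm1 by simp
  \<comment> \<open>On the interval from 1 to 3/2, \<open>c^2\<close> lies below its chord; this
    makes the next inequality linear in \<open>c\<close>.\<close>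
  have "(c - 1) * (c - 3 / 2) < 0" using c1 c2 by (simp add: mult_less_0_iff)
  then have "c\<^sup>2 < 5 / 2 * c - 3 / 2" by (simp add: field_simps power2_eq_square)
  then have "9 / 20 * (2 * c\<^sup>2 + 1) \<le> c + 1" using c2 by simp
  then have "T\<^sup>2 * (9 / 20 * (2 * c\<^sup>2 + 1)) \<le> c - 1"
    unfolding cm1 by (intro mult_left_mono) auto
  then have le: "T * (T\<^sup>2 * (9 / 20 * (2 * c\<^sup>2 + 1))) \<le> T * (c - 1)"
    using T by (intro mult_left_mono) auto
  have "t / 2 < T + 9 / 20 * T ^ 3" using less_tanh_cubic[of "t / 2"] assms by (simp add: T_def)
  then have "t / 2 * (2 * c\<^sup>2 + 1) < (T + 9 / 20 * T ^ 3) * (2 * c\<^sup>2 + 1)"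
    by (intro mult_strict_right_mono) (auto intro: add_nonneg_pos)
  also have "\<dots> = T * (2 * c\<^sup>2 + 1) + T * (T\<^sup>2 * (9 / 20 * (2 * c\<^sup>2 + 1)))"
    by (simp add: algebra_simps power2_eq_square power3_eq_cube)
  also have "\<dots> \<le> T * (c * (2 * c + 1))"
    using le by (simp add: algebra_simps power2_eq_square)
  finally have "t * (2 * c\<^sup>2 + 1) < 2 * c * (2 * c + 1) * T" by (simp add: mult_ac)
  then have "t * (2 * c\<^sup>2 + 1) * sinh t < 2 * c * (2 * c + 1) * T * sinh t"
    using assms by (intro mult_strict_right_mono) auto
  moreover have "T * sinh t = c - 1" using s cm1 by (simp add: power2_eq_square)
  then have "2 * c * (2 * c + 1) * T * sinh t = 2 * c * (2 * c + 1) * (c - 1)"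
    by (simp only: mult.assoc)
  ultimately have "t * (2 * c\<^sup>2 + 1) * sinh t < 2 * c * (2 * c + 1) * (c - 1)"
    by (simp only:)
  then show ?thesis unfolding c_def[symmetric] by (simp add: mult_ac)
qed

lemma cosh_quot_2_strict_antimono:
  assumes "0 < s" "s < t" "t < 4 / 5"
  shows "cosh_quot 2 t < cosh_quot 2 s"
proof -
  let ?f' = "\<lambda>u::real. (2 * cosh u * (2 * cosh u + 1) * (cosh u - 1)
      - u * sinh u * (2 * (cosh u)\<^sup>2 + 1)) / (u ^ 3 * (cosh u)\<^sup>2)"
  have "- cosh_quot 2 s < - cosh_quot 2 t"
  proof (rule less_of_deriv_pos[OF assms(2), where f' = ?f'])
    show "0 < ?f' u" if "s < u" "u < t" for u
      using that assms cosh_quot_2_deriv_neg[of u] by (intro divide_pos_pos) auto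
    show "((\<lambda>u. - cosh_quot 2 u) has_real_derivative ?f' u) (at u)" if "s \<le> u" "u \<le> t" for u
      unfolding cosh_quot_2 using that assms
      by (auto intro!: derivative_eq_intros simp: divide_simps)
        (simp add: algebra_simps power2_eq_square power3_eq_cube)
  qed
  then show ?thesis by simp
qed

lemma cosh_quot_2_less:
  assumes "0 < t" "t < 4 / 5"
  shows "cosh_quot 2 t < 3 / 2"
proof -
  \<comment> \<open>Comparison with the limit at 0 gives only a weak inequality, so it is applied at
    \<open>t / 2\<close>; the strict decrease from \<open>t / 2\<close> to \<open>t\<close> restores
    strictness.\<close>
  have lim: "(cosh_quot 2 \<longlongrightarrow> 3 / 2) (at_right 0)"
    unfolding cosh_quot_2[abs_def] by real_asymp
  have "\<forall>\<^sub>F s in at_right 0. cosh_quot 2 (t / 2) \<le> cosh_quot 2 s"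
    unfolding eventually_at_right_field
    using assms cosh_quot_2_strict_antimono[of _ "t / 2"] by (intro exI[of _ "t / 2"]) fastforce
  then have "cosh_quot 2 (t / 2) \<le> 3 / 2"
    by (intro tendsto_lowerbound[OF lim]) auto
  then show ?thesis using cosh_quot_2_strict_antimono[of "t / 2" t] assms by simp
qed

section \<open>Return from \<open>t = x / p\<close> to the variable \<open>x\<close>\<close>

lemma sinh_ratio_eq_sinh_quot:
  fixes x :: real
  assumes "0 < n"
  shows "(real n - sinh x / sinh (x / real n)) / x\<^sup>2 = - sinh_quot n (x / real n) / (real n)\<^sup>2"
  using assms by (simp add: sinh_quot_def power_divide diff_divide_distrib)

lemma cosh_ratio_eq_cosh_quot:
  fixes x p :: real
  assumes "0 < p"
  shows "(1 - cosh x / cosh (x / p)) / x\<^sup>2 = - cosh_quot p (x / p) / p\<^sup>2"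
  using assms by (simp add: cosh_quot_def power_divide diff_divide_distrib)

theorem theorem3:
  fixes x :: real and p :: int
  assumes "0 < x" and "x < pi / 2"
  shows "(p \<ge> 3 \<longrightarrow>
      (4 / pi\<^sup>2 * (1 - cosh (pi / 2) * sech (pi / (2 * of_int p)))
          < (1 - cosh x / cosh (x / of_int p)) / x\<^sup>2 \<and>
        (1 - cosh x / cosh (x / of_int p)) / x\<^sup>2
          < (1 - (of_int p)\<^sup>2) / (2 * (of_int p)\<^sup>2)) \<and>
      (4 / pi\<^sup>2 * (of_int p - sinh (pi / 2) * csch (pi / (2 * of_int p)))
          < (of_int p - sinh x / sinh (x / of_int p)) / x\<^sup>2 \<and>
        (of_int p - sinh x / sinh (x / of_int p)) / x\<^sup>2
          < (1 - (of_int p)\<^sup>2) / (6 * of_int p))) \<and>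
    (p = 2 \<longrightarrow>
      (4 / pi\<^sup>2 * (of_int p - sinh (pi / 2) * csch (pi / (2 * of_int p)))
          < (of_int p - sinh x / sinh (x / of_int p)) / x\<^sup>2 \<and>
        (of_int p - sinh x / sinh (x / of_int p)) / x\<^sup>2
          < (1 - (of_int p)\<^sup>2) / (6 * of_int p)) \<and>
      ((1 - (of_int p)\<^sup>2) / (2 * (of_int p)\<^sup>2)
          < (1 - cosh x / cosh (x / of_int p)) / x\<^sup>2 \<and>
        (1 - cosh x / cosh (x / of_int p)) / x\<^sup>2
          < 4 / pi\<^sup>2 * (1 - cosh (pi / 2) * sech (pi / (2 * of_int p)))))"
proof -
  define n where "n = nat p"
  have sinh_bounds:
    "4 / pi\<^sup>2 * (of_int p - sinh (pi / 2) * csch (pi / (2 * of_int p)))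
        < (of_int p - sinh x / sinh (x / of_int p)) / x\<^sup>2 \<and>
      (of_int p - sinh x / sinh (x / of_int p)) / x\<^sup>2
        < (1 - (of_int p)\<^sup>2) / (6 * of_int p)" if "2 \<le> p"
  proof -
    have n: "2 \<le> n" "real_of_int p = real n" using that by (auto simp: n_def)
    \<comment> \<open>The lower bound is the quotient itself at \<open>x = pi / 2\<close>, so the
      inequality becomes strict monotonicity.\<close>
    have "4 / pi\<^sup>2 * (real n - sinh (pi / 2) * csch (pi / (2 * real n)))
        = (real n - sinh (pi / 2) / sinh (pi / 2 / real n)) / (pi / 2)\<^sup>2"
      by (simp add: csch_def power_divide)
    also have "\<dots> = - sinh_quot n (pi / 2 / real n) / (real n)\<^sup>2"
      using n by (intro sinh_ratio_eq_sinh_quot) auto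
    also have "\<dots> < - sinh_quot n (x / real n) / (real n)\<^sup>2"
    proof (intro divide_strict_right_mono)
      have "x / real n < pi / 2 / real n" using n assms by (intro divide_strict_right_mono) auto
      then show "- sinh_quot n (pi / 2 / real n) < - sinh_quot n (x / real n)"
        using n assms sinh_quot_strict_mono[of n "x / real n" "pi / 2 / real n"] by simp
    qed (use n in simp)
    finally have "4 / pi\<^sup>2 * (real n - sinh (pi / 2) * csch (pi / (2 * real n)))
        < (real n - sinh x / sinh (x / real n)) / x\<^sup>2"
      using n by (simp add: sinh_ratio_eq_sinh_quot)
    moreover have "- sinh_quot n (x / real n) / (real n)\<^sup>2
        < - (real n * ((real n)\<^sup>2 - 1) / 6) / (real n)\<^sup>2"
      using n assms less_sinh_quot[of n "x / real n"] by (intro divide_strict_right_mono) auto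
    moreover have "\<dots> = (1 - (real n)\<^sup>2) / (6 * real n)"
      using n by (simp add: field_simps power2_eq_square)
    ultimately show ?thesis using n by (simp add: sinh_ratio_eq_sinh_quot)
  qed
  have cosh_end: "4 / pi\<^sup>2 * (1 - cosh (pi / 2) * sech (pi / (2 * q)))
      = - cosh_quot q (pi / 2 / q) / q\<^sup>2" if "0 < q" for q
    using cosh_ratio_eq_cosh_quot[OF that, of "pi / 2"] by (simp add: sech_def power_divide mult.commute)
  have cosh_bounds:
    "4 / pi\<^sup>2 * (1 - cosh (pi / 2) * sech (pi / (2 * q)))
        < (1 - cosh x / cosh (x / q)) / x\<^sup>2 \<and>
      (1 - cosh x / cosh (x / q)) / x\<^sup>2 < (1 - q\<^sup>2) / (2 * q\<^sup>2)" if "3 \<le> q" for q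
  proof -
    have "- cosh_quot q (pi / 2 / q) / q\<^sup>2 < - cosh_quot q (x / q) / q\<^sup>2"
    proof (intro divide_strict_right_mono)
      have "x / q < pi / 2 / q" using that assms by (intro divide_strict_right_mono) auto
      then show "- cosh_quot q (pi / 2 / q) < - cosh_quot q (x / q)"
        using that assms cosh_quot_strict_mono[of q "x / q" "pi / 2 / q"] by simp
    qed (use that in simp)
    moreover have "- cosh_quot q (x / q) / q\<^sup>2 < - ((q\<^sup>2 - 1) / 2) / q\<^sup>2"
      using that assms less_cosh_quot[of q "x / q"] by (intro divide_strict_right_mono) auto
    moreover have "- ((q\<^sup>2 - 1) / 2) / q\<^sup>2 = (1 - q\<^sup>2) / (2 * q\<^sup>2)" by (simp add: minus_divide_left)
    moreover have "0 < q" using that by simp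
    ultimately show ?thesis by (simp only: cosh_end cosh_ratio_eq_cosh_quot[of q x])
  qed
  have cosh_bounds_2:
    "(1 - 2\<^sup>2) / (2 * 2\<^sup>2) < (1 - cosh x / cosh (x / 2)) / x\<^sup>2 \<and>
      (1 - cosh x / cosh (x / 2)) / x\<^sup>2
        < 4 / pi\<^sup>2 * (1 - cosh (pi / 2) * sech (pi / (2 * 2)))"
  proof -
    \<comment> \<open>Here \<open>t = x / 2\<close> stays below \<open>pi / 4\<close>; this is the
      origin of the range \<open>t < 4 / 5\<close> and of \<open>2 / 5\<close> for its half.\<close>
    have "pi / 2 / 2 < 4 / 5" using pi_approx by simp
    then have "cosh_quot 2 (x / 2) < 3 / 2" "cosh_quot 2 (pi / 2 / 2) < cosh_quot 2 (x / 2)"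
      using assms cosh_quot_2_less[of "x / 2"] cosh_quot_2_strict_antimono[of "x / 2" "pi / 2 / 2"]
      by auto
    then show ?thesis
      unfolding cosh_end[OF zero_less_numeral] cosh_ratio_eq_cosh_quot[OF zero_less_numeral] by simp
  qed
  show ?thesis
  proof (rule conjI; rule impI)
    assume "3 \<le> p"
    then have p: "3 \<le> real_of_int p" "2 \<le> p" by auto
    show "(4 / pi\<^sup>2 * (1 - cosh (pi / 2) * sech (pi / (2 * of_int p)))
          < (1 - cosh x / cosh (x / of_int p)) / x\<^sup>2 \<and>
        (1 - cosh x / cosh (x / of_int p)) / x\<^sup>2
          < (1 - (of_int p)\<^sup>2) / (2 * (of_int p)\<^sup>2)) \<and>
      (4 / pi\<^sup>2 * (of_int p - sinh (pi / 2) * csch (pi / (2 * of_int p)))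
          < (of_int p - sinh x / sinh (x / of_int p)) / x\<^sup>2 \<and>
        (of_int p - sinh x / sinh (x / of_int p)) / x\<^sup>2
          < (1 - (of_int p)\<^sup>2) / (6 * of_int p))"
      by (rule conjI[OF cosh_bounds[OF p(1)] sinh_bounds[OF p(2)]])
  next
    assume "p = 2"
    then have "2 \<le> p" and p: "real_of_int p = 2" by auto
    show "(4 / pi\<^sup>2 * (of_int p - sinh (pi / 2) * csch (pi / (2 * of_int p)))
          < (of_int p - sinh x / sinh (x / of_int p)) / x\<^sup>2 \<and>
        (of_int p - sinh x / sinh (x / of_int p)) / x\<^sup>2
          < (1 - (of_int p)\<^sup>2) / (6 * of_int p)) \<and>
      ((1 - (of_int p)\<^sup>2) / (2 * (of_int p)\<^sup>2)
          < (1 - cosh x / cosh (x / of_int p)) / x\<^sup>2 \<and>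
        (1 - cosh x / cosh (x / of_int p)) / x\<^sup>2
          < 4 / pi\<^sup>2 * (1 - cosh (pi / 2) * sech (pi / (2 * of_int p))))"
      unfolding p by (rule conjI[OF sinh_bounds[OF \<open>2 \<le> p\<close>, unfolded p] cosh_bounds_2])
  qed
qed

end
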